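(* Let $\mathcal A\subseteq\mathbb N$, $L$ an environment and $T$ a term. If $L\vdash_{\mathcal A}T$, then there exists an arity $A$ such that $L\vdash T::A$.
   Context: Fix a nonempty set $\Sigma$ of sorts with decidable equality, an arbitrary function $\mathrm{next}:\Sigma\to\Sigma$, and a countably infinite set of variables. Terms and environments: $T,U,V,W ::= \star s \mid x \mid \mathrm{app}(V,T) \mid \lambda x{:}W.\,T \mid \mathrm{def}(x{=}V).\,T \mid \mathrm{cast}(U,T)$ ($s\in\Sigma$) and $L,K ::= \emptyset \mid K,x{:}W \mid K,x{=}V$. $\mathrm{app}(V,T)$ applies $T$ to $V$; $\lambda x{:}W.\,T$ (de Bruijn's abstraction) and $\mathrm{def}(x{=}V).\,T$ (local definition) bind $x$ in $T$; $\mathrm{cast}(U,T)$ annotates $T$ with expected type $U$; entries $x{:}W$ (declaration) and $x{=}V$ (definition) bind $x$. Terms are modulo renaming of bound variables, with bound variables distinct from each other and from free ones. Write $\mathsf{B}x[V]$ for either $\lambda x{:}V$ or $\mathrm{def}(x{=}V)$ and correspondingly $L,x[V]$ for $L,x{:}V$ resp. $L,x{=}V$. One step of bound rt-reduction $L\vdash T_1\to^nT_2$ is the smallest relation closed under: $L\vdash\mathrm{app}(V,\lambda x{:}W.\,T)\to^0\mathrm{def}(x{=}\mathrm{cast}(W,V)).\,T$; $K,x{=}V\vdash x\to^0V$; $L\vdash\mathrm{def}(x{=}V).\,T\to^0T$ if $x$ not free in $T$; $L\vdash\mathrm{app}(V,\mathrm{def}(x{=}W).\,T)\to^0\mathrm{def}(x{=}W).\,\mathrm{app}(V,T)$;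 $L\vdash\mathrm{cast}(U,T)\to^0T$; $L\vdash\star s\to^1\star\,\mathrm{next}(s)$; $K,x{:}W\vdash x\to^1W$; $L\vdash\mathrm{cast}(U,T)\to^1U$; if $K\vdash x\to^nT$, $y\neq x$, $y$ not free in $T$ then $K,y[V]\vdash x\to^nT$; if $L\vdash V_1\to^0V_2$ then $L\vdash\mathrm{app}(V_1,T)\to^0\mathrm{app}(V_2,T)$; if $L\vdash T_1\to^nT_2$ then $L\vdash\mathrm{app}(V,T_1)\to^n\mathrm{app}(V,T_2)$; if $L\vdash V_1\to^0V_2$ then $L\vdash\mathsf Bx[V_1].\,T\to^0\mathsf Bx[V_2].\,T$; if $L,x[V]\vdash T_1\to^nT_2$ then $L\vdash\mathsf Bx[V].\,T_1\to^n\mathsf Bx[V].\,T_2$; if $L\vdash U_1\to^0U_2$ then $L\vdash\mathrm{cast}(U_1,T)\to^0\mathrm{cast}(U_2,T)$; if $L\vdash T_1\to^0T_2$ then $L\vdash\mathrm{cast}(U,T_1)\to^0\mathrm{cast}(U,T_2)$; if $L\vdash U_1\to^1U_2$ and $L\vdash T_1\to^1T_2$ then $L\vdash\mathrm{cast}(U_1,T_1)\to^1\mathrm{cast}(U_2,T_2)$. The relation $L\vdash T_1\to^{*n}T_2$ is the smallest with $L\vdash T\to^{*0}T$, containing single steps, and with $L\vdash T_1\to^{*n_1}T$, $L\vdash T\to^{*n_2}T_2$ implying $L\vdash T_1\to^{*n_1+n_2}T_2$. Validity $L\vdash_{\mathcal A}T$ (for $\mathcal A\subseteq\mathbb N$)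 is the smallest predicate closed under: $L\vdash_{\mathcal A}\star s$; if $K\vdash_{\mathcal A}V$ then $K,x[V]\vdash_{\mathcal A}x$; if $K\vdash_{\mathcal A}x$ and $y\neq x$ then $K,y[V]\vdash_{\mathcal A}x$; if $L\vdash_{\mathcal A}V$ and $L,x[V]\vdash_{\mathcal A}T$ then $L\vdash_{\mathcal A}\mathsf Bx[V].\,T$; if $L\vdash_{\mathcal A}U$, $L\vdash_{\mathcal A}T$ and some $U_0$ satisfies $L\vdash T\to^{*1}U_0$ and $L\vdash U\to^{*0}U_0$, then $L\vdash_{\mathcal A}\mathrm{cast}(U,T)$; if $L\vdash_{\mathcal A}V$, $L\vdash_{\mathcal A}T$ and there are $n\in\mathcal A$ and $x,W_0,U_0$ with $L\vdash T\to^{*n}\lambda x{:}W_0.\,U_0$ and $L\vdash V\to^{*1}W_0$, then $L\vdash_{\mathcal A}\mathrm{app}(V,T)$. Arities are $A,B::=\circ\mid B\Rightarrow A$. Arity assignment $L\vdash T::A$ is the smallest relation closed under: $L\vdash\star s::\circ$; if $K\vdash V::A$ then $K,x[V]\vdash x::A$; if $K\vdash x::A$ and $y\neq x$ then $K,y[V]\vdash x::A$; if $L\vdash W::B$ and $L,x{:}W\vdash T::A$ then $L\vdash\lambda x{:}W.\,T::B\Rightarrow A$; if $L\vdash V::B$ and $L,x{=}V\vdash T::A$ then $L\vdash\mathrm{def}(x{=}V).\,T::A$; if $L\vdash V::B$ and $L\vdash T::B\Rightarrow A$ then $L\vdash\mathrm{app}(V,T)::A$; if $L\vdash U::A$ and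 $L\vdash T::A$ then $L\vdash\mathrm{cast}(U,T)::A$. *)

theory Defs
  imports Main
begin

text \<open>
  Terms modulo renaming of bound variables are represented by de Bruijn indices: \<open>Var i\<close> refers
  to the \<open>i\<close>-th enclosing binder, counting from the innermost one and continuing into the
  environment, whose most recent entry is the head of the list.  Indices beyond the length of the
  environment are free variables that it does not bind.  The sorts are the elements of the type
  \<open>'s\<close>.
\<close>

datatype bkind = Abst | Abbr

text \<open>
  As in the calculus, the argument precedes the function in \<open>App V T\<close> and the expected type
  precedes the term in \<open>Cast U T\<close>.  \<open>Bind b V T\<close> binds index \<open>0\<close> in \<open>T\<close> but not in \<open>V\<close>.
\<close>

datatype 's trm =
    Sort 's
  | Var nat
  | App "'s trm" "'s trm"
  | Bind bkind "'s trm" "'s trm"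
  | Cast "'s trm" "'s trm"

abbreviation Lam :: "'s trm \<Rightarrow> 's trm \<Rightarrow> 's trm" where
  "Lam W T \<equiv> Bind Abst W T"

abbreviation Def :: "'s trm \<Rightarrow> 's trm \<Rightarrow> 's trm" where
  "Def V T \<equiv> Bind Abbr V T"

text \<open>\<open>(Abst, W) # K\<close> stands for \<open>K, x:W\<close> and \<open>(Abbr, V) # K\<close> for \<open>K, x=V\<close>.\<close>

type_synonym 's env = "(bkind \<times> 's trm) list"

text \<open>
  \<open>lift k T\<close> makes room in \<open>T\<close> for one more variable at index \<open>k\<close>.  The terms of the form
  \<open>lift 0 T\<close> are those in which variable \<open>0\<close> is not free, \<open>T\<close> being the same term read outside
  the scope of that variable.
\<close>

primrec lift :: "nat \<Rightarrow> 's trm \<Rightarrow> 's trm" where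
  "lift k (Sort s) = Sort s"
| "lift k (Var i) = Var (if i < k then i else Suc i)"
| "lift k (App V T) = App (lift k V) (lift k T)"
| "lift k (Bind b V T) = Bind b (lift k V) (lift (Suc k) T)"
| "lift k (Cast U T) = Cast (lift k U) (lift k T)"

text \<open>
  \<open>red nxt n L T1 T2\<close> is one step of bound rt-reduction \<open>L \<turnstile> T1 \<rightarrow>\<^sup>n T2\<close>.
\<close>

inductive red :: "('s \<Rightarrow> 's) \<Rightarrow> nat \<Rightarrow> 's env \<Rightarrow> 's trm \<Rightarrow> 's trm \<Rightarrow> bool"
  for nxt :: "'s \<Rightarrow> 's" where
  beta: "red nxt 0 L (App V (Lam W T)) (Def (Cast W V) T)"
| delta: "red nxt 0 ((Abbr, V) # K) (Var 0) (lift 0 V)"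
| zeta: "red nxt 0 L (Def V (lift 0 T)) T"
| theta: "red nxt 0 L (App V (Def W T)) (Def W (App (lift 0 V) T))"
| epsilon: "red nxt 0 L (Cast U T) T"
| sort: "red nxt 1 L (Sort s) (Sort (nxt s))"
| ell: "red nxt 1 ((Abst, W) # K) (Var 0) (lift 0 W)"
| ee: "red nxt 1 L (Cast U T) U"
| skip: "red nxt n K (Var i) T \<Longrightarrow> red nxt n ((b, V) # K) (Var (Suc i)) (lift 0 T)"
| app_arg: "red nxt 0 L V1 V2 \<Longrightarrow> red nxt 0 L (App V1 T) (App V2 T)"
| app_fun: "red nxt n L T1 T2 \<Longrightarrow> red nxt n L (App V T1) (App V T2)"
| bind_head: "red nxt 0 L V1 V2 \<Longrightarrow> red nxt 0 L (Bind b V1 T) (Bind b V2 T)"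
| bind_body: "red nxt n ((b, V) # L) T1 T2 \<Longrightarrow> red nxt n L (Bind b V T1) (Bind b V T2)"
| cast_type: "red nxt 0 L U1 U2 \<Longrightarrow> red nxt 0 L (Cast U1 T) (Cast U2 T)"
| cast_term: "red nxt 0 L T1 T2 \<Longrightarrow> red nxt 0 L (Cast U T1) (Cast U T2)"
| cast_both: "red nxt 1 L U1 U2 \<Longrightarrow> red nxt 1 L T1 T2 \<Longrightarrow>
    red nxt 1 L (Cast U1 T1) (Cast U2 T2)"

text \<open>\<open>reds nxt n L T1 T2\<close> is \<open>L \<turnstile> T1 \<rightarrow>\<^sup>*\<^sup>n T2\<close>.\<close>

inductive reds :: "('s \<Rightarrow> 's) \<Rightarrow> nat \<Rightarrow> 's env \<Rightarrow> 's trm \<Rightarrow> 's trm \<Rightarrow> bool"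
  for nxt :: "'s \<Rightarrow> 's" where
  refl: "reds nxt 0 L T T"
| step: "red nxt n L T1 T2 \<Longrightarrow> reds nxt n L T1 T2"
| trans: "reds nxt n1 L T1 T \<Longrightarrow> reds nxt n2 L T T2 \<Longrightarrow> reds nxt (n1 + n2) L T1 T2"

inductive valid :: "('s \<Rightarrow> 's) \<Rightarrow> nat set \<Rightarrow> 's env \<Rightarrow> 's trm \<Rightarrow> bool"
  for nxt :: "'s \<Rightarrow> 's" and \<A> :: "nat set" where
  sort: "valid nxt \<A> L (Sort s)"
| var_zero: "valid nxt \<A> K V \<Longrightarrow> valid nxt \<A> ((b, V) # K) (Var 0)"
| var_Suc: "valid nxt \<A> K (Var i) \<Longrightarrow> valid nxt \<A> ((b, V) # K) (Var (Suc i))"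
| bind: "valid nxt \<A> L V \<Longrightarrow> valid nxt \<A> ((b, V) # L) T \<Longrightarrow> valid nxt \<A> L (Bind b V T)"
| cast: "valid nxt \<A> L U \<Longrightarrow> valid nxt \<A> L T \<Longrightarrow>
    reds nxt 1 L T U0 \<Longrightarrow> reds nxt 0 L U U0 \<Longrightarrow> valid nxt \<A> L (Cast U T)"
| app: "valid nxt \<A> L V \<Longrightarrow> valid nxt \<A> L T \<Longrightarrow> n \<in> \<A> \<Longrightarrow>
    reds nxt n L T (Lam W0 U0) \<Longrightarrow> reds nxt 1 L V W0 \<Longrightarrow> valid nxt \<A> L (App V T)"

datatype arity = Base | Arrow arity arity

inductive has_arity :: "'s env \<Rightarrow> 's trm \<Rightarrow> arity \<Rightarrow> bool" where
  sort: "has_arity L (Sort s) Base"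
| var_zero: "has_arity K V A \<Longrightarrow> has_arity ((b, V) # K) (Var 0) A"
| var_Suc: "has_arity K (Var i) A \<Longrightarrow> has_arity ((b, V) # K) (Var (Suc i)) A"
| lam: "has_arity L W B \<Longrightarrow> has_arity ((Abst, W) # L) T A \<Longrightarrow>
    has_arity L (Lam W T) (Arrow B A)"
| abbr: "has_arity L V B \<Longrightarrow> has_arity ((Abbr, V) # L) T A \<Longrightarrow> has_arity L (Def V T) A"
| app: "has_arity L V B \<Longrightarrow> has_arity L T (Arrow B A) \<Longrightarrow> has_arity L (App V T) A"
| cast: "has_arity L U A \<Longrightarrow> has_arity L T A \<Longrightarrow> has_arity L (Cast U T) A"

end

theory Submission
  imports Defs
begin

text \<open>
  Arities are unique and every rt-reduction step preserves them, whatever its bound \<open>n\<close>: an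
  environment enters arity assignment only through the arities of its variables, so that beta,
  which replaces the entry \<open>x:W\<close> by \<open>x=cast(W,V)\<close>, is harmless.  Hence the reductions required
  by validity of applications and casts force the arities of the immediate subterms to match.
\<close>

inductive_cases has_arity_SortE [elim!]: "has_arity L (Sort s) A"
inductive_cases has_arity_Var_zeroE [elim!]: "has_arity ((b, V) # L) (Var 0) A"
inductive_cases has_arity_Var_SucE [elim!]: "has_arity ((b, V) # L) (Var (Suc i)) A"
inductive_cases has_arity_BindE [consumes 1, case_names lam abbr]: "has_arity L (Bind b V T) A"
inductive_cases has_arity_LamE [elim!]: "has_arity L (Lam W T) A"
inductive_cases has_arity_DefE [elim!]: "has_arity L (Def V T) A"
inductive_cases has_arity_AppE [elim!]: "has_arity L (App V T) A"
inductive_cases has_arity_CastE [elim!]: "has_arity L (Cast U T) A"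

text \<open>The rules are syntax-directed; for an application the arity of the function already
  fixes that of the result.\<close>

lemma has_arity_unique:
  assumes "has_arity L T A" and "has_arity L T B"
  shows "A = B"
  using assms
proof (induction arbitrary: B rule: has_arity.induct)
  case (lam L W B' T A)
  from lam.prems lam.IH show ?case by blast
qed blast+

text \<open>Both binder rules have one premise on \<open>V\<close> and one on the body, so
  transferring these transfers the whole term. This handles abstraction and definition uniformly for
  an unknown \<open>b\<close>.\<close>

lemma has_arity_Bind_mono:
  assumes "has_arity L (Bind b V T) A"
    and V: "\<And>C. has_arity L V C \<Longrightarrow> has_arity L' V' C"
    and T: "\<And>C. has_arity ((b, V) # L) T C \<Longrightarrow> has_arity ((b, V') # L') T' C"
  shows "has_arity L' (Bind b V' T') A"
  using assms(1)
proof (cases rule: has_arity_BindE)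
  case lam
  then show ?thesis using V T by (auto intro: has_arity.lam)
next
  case abbr
  then show ?thesis using V T by (metis has_arity.abbr)
qed

text \<open>The assumption survives passing under a binder: variable \<open>0\<close> takes the
  arity of \<open>V\<close>, which transfers by induction, and the other variables come from
  outside.\<close>

lemma has_arity_mono:
  assumes "has_arity L T A"
    and "\<And>i A. has_arity L (Var i) A \<Longrightarrow> has_arity L' (Var i) A"
  shows "has_arity L' T A"
  using assms
proof (induction T arbitrary: L L' A)
  case (Bind b V T)
  have V: "has_arity L' V C" if "has_arity L V C" for C
    using Bind.IH(1) Bind.prems(2) that by blast
  have "has_arity ((b, V) # L') (Var i) C" if "has_arity ((b, V) # L) (Var i) C" for i C
    using that V Bind.prems(2) by (cases i) (auto intro: has_arity.intros)
  then have T: "has_arity ((b, V) # L') T C" if "has_arity ((b, V) # L) T C" for C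
    using Bind.IH(2) that by blast
  from Bind.prems(1) V T show ?case
    by (rule has_arity_Bind_mono)
qed (blast intro: has_arity.intros)+

text \<open>Relating \<open>L\<close> and \<open>L'\<close> only through their variables covers
  inserting an entry at any depth \<open>k\<close> without describing the shape of
  \<open>L'\<close>; under a binder the assumption reappears at \<open>Suc k\<close>.\<close>

lemma has_arity_lift:
  assumes "has_arity L T A"
    and "\<And>i A. has_arity L (Var i) A \<Longrightarrow> has_arity L' (lift k (Var i)) A"
  shows "has_arity L' (lift k T) A"
  using assms
proof (induction T arbitrary: L L' A k)
  case (Bind b V T)
  have V: "has_arity L' (lift k V) C" if "has_arity L V C" for C
    using Bind.IH(1) Bind.prems(2) that by blast
  have "has_arity ((b, lift k V) # L') (lift (Suc k) (Var i)) C"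
    if "has_arity ((b, V) # L) (Var i) C" for i C
    \<comment> \<open>For \<open>i = Suc j\<close> the instance is about \<open>j\<close>, the same
      variable seen outside the binder, and \<open>i < Suc k\<close> becomes \<open>j < k\<close>;
      for \<open>i = 0\<close> the arity of \<open>V\<close> decides.\<close>
    using that V Bind.prems(2)[of "i - 1"]
    by (cases i) (auto intro: has_arity.intros split: if_splits)
  then have T: "has_arity ((b, lift k V) # L') (lift (Suc k) T) C"
    if "has_arity ((b, V) # L) T C" for C
    using Bind.IH(2) that by blast
  show ?case
    unfolding lift.simps using Bind.prems(1) V T by (rule has_arity_Bind_mono)
next
  case (App V T)
  from App.prems(1) obtain B where "has_arity L V B" "has_arity L T (Arrow B A)"
    by blast
  then have "has_arity L' (lift k V) B" "has_arity L' (lift k T) (Arrow B A)"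
    using App.IH App.prems(2) by blast+
  then show ?case by (auto intro: has_arity.app)
next
  case (Cast U T)
  from Cast.prems(1) have "has_arity L U A" "has_arity L T A"
    by blast+
  then have "has_arity L' (lift k U) A" "has_arity L' (lift k T) A"
    using Cast.IH Cast.prems(2) by blast+
  then show ?case by (auto intro: has_arity.cast)
qed (auto intro: has_arity.intros)

text \<open>The converse transfer, which zeta requires when it drops a definition around a lifted
  body.\<close>

lemma has_arity_lift_inv:
  assumes "has_arity L' (lift k T) A"
    and "\<And>i A. has_arity L' (lift k (Var i)) A \<Longrightarrow> has_arity L (Var i) A"
  shows "has_arity L T A"
  using assms
proof (induction T arbitrary: L L' A k)
  case (Bind b V T)
  have V: "has_arity L V C" if "has_arity L' (lift k V) C" for C
    using Bind.IH(1) Bind.prems(2) that by blast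
  have "has_arity ((b, V) # L) (Var i) C"
    if "has_arity ((b, lift k V) # L') (lift (Suc k) (Var i)) C" for i C
    using that V Bind.prems(2)[of "i - 1"]
    by (cases i) (auto intro: has_arity.intros split: if_splits)
  then have T: "has_arity ((b, V) # L) T C"
    if "has_arity ((b, lift k V) # L') (lift (Suc k) T) C" for C
    using Bind.IH(2) that by blast
  from Bind.prems(1)[unfolded lift.simps] V T show ?case
    by (rule has_arity_Bind_mono)
next
  case (App V T)
  from App.prems(1) obtain B where "has_arity L' (lift k V) B" "has_arity L' (lift k T) (Arrow B A)"
    by auto
  then show ?case using App.IH App.prems(2) by (blast intro: has_arity.app)
next
  case (Cast U T)
  from Cast.prems(1) have "has_arity L' (lift k U) A" "has_arity L' (lift k T) A"
    by auto
  then show ?case using Cast.IH Cast.prems(2) by (blast intro: has_arity.cast)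
qed (auto intro: has_arity.intros)

lemma has_arity_lift_zero_iff:
  "has_arity ((b, V) # L) (lift 0 T) A \<longleftrightarrow> has_arity L T A"
proof
  show "has_arity L T A" if "has_arity ((b, V) # L) (lift 0 T) A"
    using that by (rule has_arity_lift_inv) auto
  show "has_arity ((b, V) # L) (lift 0 T) A" if "has_arity L T A"
    using that by (rule has_arity_lift) (simp add: has_arity.var_Suc)
qed

text \<open>The kind of the head entry may change from \<open>b\<close> to \<open>b'\<close>, since
  \<open>var_zero\<close> looks only at the arity of the entry's term; beta exploits this.\<close>

lemma has_arity_head_mono:
  assumes "has_arity ((b, V) # L) T A"
    and "\<And>A. has_arity L V A \<Longrightarrow> has_arity L V' A"
  shows "has_arity ((b', V') # L) T A"
  using assms(1)
proof (rule has_arity_mono)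
  fix i C
  assume "has_arity ((b, V) # L) (Var i) C"
  then show "has_arity ((b', V') # L) (Var i) C"
    using assms(2) by (cases i) (auto intro: has_arity.intros)
qed

text \<open>Type steps keep arities too: all sorts have arity \<open>Base\<close>, a declared
  variable shares the arity of its type, and both parts of a cast have the same arity.\<close>

lemma red_has_arity:
  assumes "red nxt n L T1 T2" and "has_arity L T1 A"
  shows "has_arity L T2 A"
  using assms
proof (induction arbitrary: A rule: red.induct)
  case (beta L V W T)
  then obtain B where V: "has_arity L V B" and W: "has_arity L W B"
    and T: "has_arity ((Abst, W) # L) T A"
    by blast
  from V W have cast: "has_arity L (Cast W V) B" by (rule has_arity.cast[rotated])
  \<comment> \<open>By uniqueness \<open>B\<close> is the only arity of \<open>W\<close>, and
    \<open>Cast W V\<close> has it as well.\<close>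
  have "has_arity ((Abbr, Cast W V) # L) T A"
    using T by (rule has_arity_head_mono) (metis W cast has_arity_unique)
  with cast show ?case by (rule has_arity.abbr)
next
  case (bind_head L V1 V2 b T)
  have T: "has_arity ((b, V2) # L) T C" if "has_arity ((b, V1) # L) T C" for C
    using that bind_head.IH by (rule has_arity_head_mono)
  from bind_head.prems bind_head.IH T show ?case
    by (rule has_arity_Bind_mono)
next
  case (bind_body n b V L T1 T2)
  from bind_body.prems show ?case
    by (rule has_arity_Bind_mono) (auto intro: bind_body.IH)
next
  case (theta L V W T)
  then obtain B C where "has_arity L V B" and W: "has_arity L W C"
    and T: "has_arity ((Abbr, W) # L) T (Arrow B A)"
    by blast
  then have "has_arity ((Abbr, W) # L) (lift 0 V) B"
    by (simp add: has_arity_lift_zero_iff)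
  from W has_arity.app[OF this T] show ?case by (rule has_arity.abbr)
qed (auto simp: has_arity_lift_zero_iff intro: has_arity.intros)

lemma reds_has_arity:
  assumes "reds nxt n L T1 T2" and "has_arity L T1 A"
  shows "has_arity L T2 A"
  using assms by (induction rule: reds.induct) (auto intro: red_has_arity)

theorem theorem4p4:
  fixes nxt :: "'s \<Rightarrow> 's" and \<A> :: "nat set" and L :: "'s env" and T :: "'s trm"
  assumes "valid nxt \<A> L T"
  shows "\<exists>A. has_arity L T A"
  using assms
proof (induction rule: valid.induct)
  case (bind L V b T)
  then show ?case by (cases b) (auto intro: has_arity.intros)
next
  case (cast L U T U0)
  then obtain A B where U: "has_arity L U A" and T: "has_arity L T B" by blast
  \<comment> \<open>The common reduct \<open>U0\<close> inherits the arities of both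
    \<open>U\<close> and \<open>T\<close>.\<close>
  with cast.hyps have "has_arity L U0 A" "has_arity L U0 B"
    by (auto intro: reds_has_arity)
  then have "A = B" by (rule has_arity_unique)
  with U T show ?case by (auto intro: has_arity.cast)
next
  case (app L V T n W0 U0)
  then obtain B C where V: "has_arity L V B" and T: "has_arity L T C" by blast
  \<comment> \<open>\<open>T\<close> reduces to an abstraction, so its arity \<open>C\<close> must
    be an arrow with the arity of \<open>W0\<close> as domain; \<open>V\<close> reduces to
    \<open>W0\<close>, which makes that domain \<open>B\<close>.\<close>
  from reds_has_arity[OF app.hyps(4) T] obtain B' A
    where C: "C = Arrow B' A" and "has_arity L W0 B'" by blast
  moreover have "has_arity L W0 B" using reds_has_arity[OF app.hyps(5) V] .
  ultimately have "B' = B" by (blast intro: has_arity_unique)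
  with V T C show ?case by (auto intro: has_arity.app)
qed (auto intro: has_arity.intros)

end
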